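(* Let $0 \le \sigma \le \frac12$ and let $A \subseteq \{0,1\}^n$ with $|A| \le 2^{H(\sigma) n}$. Then for every integer $1 \le i \le 2\sigma(1-\sigma) n$, \[ a_i(A) \quad \le \quad |A| \cdot 2^{\left(\sigma H\left(\frac{i}{2\sigma n}\right) + (1-\sigma)H\left(\frac{i}{2(n-\sigma n)}\right)\right) \cdot n}. \] Moreover, let $s = \sigma n$ be an integer with $s\ge1$. There is an absolute constant $C$ such that: if $i$ is even with $1\le i\le 2\sigma(1-\sigma)n$ and $A$ is the Hamming sphere of radius $s$ around $0$, then the right-hand side above is at most $C\, i\, a_i(A)$; and for every integer $1\le i\le 2\sigma(1-\sigma)n$, if $A$ is the union of the two Hamming spheres of radii $s-1$ and $s$ around $0$ in the $(n-1)$-dimensional subcube $\{x\in\{0,1\}^n: x_n=0\}$, then the right-hand side above is at most $C\sqrt{\frac{n-s}{s}}\, i\, a_i(A)$.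
   Context: $H(t)=-t\log_2 t-(1-t)\log_2(1-t)$ is the binary entropy function. For $A\subseteq\{0,1\}^n$, $a_i(A)=|\{(x,y)\in A\times A: |x-y|=i\}|$, where $|x-y|$ is the Hamming distance. The Hamming sphere of radius $r$ around $x$ is $\{y:|x-y|=r\}$. *)

theory Defs
  imports Complex_Main "HOL-Library.FuncSet"
begin

definition bin_entropy :: "real \<Rightarrow> real" where
  "bin_entropy t = - t * log 2 t - (1 - t) * log 2 (1 - t)"

text \<open>Points of the cube are functions on \<open>{1..n}\<close>, extended by \<open>undefined\<close> outside,
  so that \<open>cube n\<close> is finite of cardinality \<open>2 ^ n\<close>.\<close>

definition cube :: "nat \<Rightarrow> (nat \<Rightarrow> nat) set" where
  "cube n = {1..n} \<rightarrow>\<^sub>E {0, 1}"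

definition hamming_dist :: "nat \<Rightarrow> (nat \<Rightarrow> nat) \<Rightarrow> (nat \<Rightarrow> nat) \<Rightarrow> nat" where
  "hamming_dist n x y = card {k \<in> {1..n}. x k \<noteq> y k}"

definition cube_zero :: "nat \<Rightarrow> nat \<Rightarrow> nat" where
  "cube_zero n = (\<lambda>k\<in>{1..n}. 0)"

definition hamming_sphere :: "nat \<Rightarrow> (nat \<Rightarrow> nat) \<Rightarrow> nat \<Rightarrow> (nat \<Rightarrow> nat) set" where
  "hamming_sphere n x r = {y \<in> cube n. hamming_dist n x y = r}"

definition dist_count :: "nat \<Rightarrow> nat \<Rightarrow> (nat \<Rightarrow> nat) set \<Rightarrow> nat" where
  "dist_count n i A = card {(x, y) \<in> A \<times> A. hamming_dist n x y = i}"

definition dist_bound :: "nat \<Rightarrow> real \<Rightarrow> nat \<Rightarrow> (nat \<Rightarrow> nat) set \<Rightarrow> real" where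
  "dist_bound n \<sigma> i A = real (card A) *
     2 powr ((\<sigma> * bin_entropy (real i / (2 * \<sigma> * real n))
              + (1 - \<sigma>) * bin_entropy (real i / (2 * (real n - \<sigma> * real n)))) * real n)"

end

theory Submission
  imports Defs
begin

text \<open>
  For \<open>0 < \<kappa> \<le> 1\<close> the number of pairs at distance \<open>i\<close> is at most \<open>\<kappa>\<^sup>-\<^sup>i\<close> times the sum of
  \<open>\<kappa> ^ dist x y\<close> over all pairs. This quadratic form satisfies an \<open>L\<^sup>p\<close> bound that tensorises, so
  it is controlled by an inequality on two points. With \<open>d = i / (2 n)\<close>, \<open>q0 = 1 - \<sigma> - d\<close> and
  \<open>q1 = \<sigma> - d\<close>, the parameters \<open>\<kappa> = d / sqrt (q0 q1)\<close> and \<open>\<theta> = 1 / p\<close> with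
  \<open>((1 - \<sigma>) / \<sigma>) powr \<theta> = sqrt (q0 / q1)\<close> place the maximum of the two-point ratio at
  \<open>(1 - \<sigma>, \<sigma>)\<close>, and the resulting exponent is exactly the conditional entropy in the bound.

  For the converse, the pairs in the sphere and in the two spheres are counted by products of
  binomial coefficients, and Stirling bounds compare these with \<open>2 powr (m * H (h / m))\<close>, where \<open>h = i / 2\<close>
  is an integer in the even case and a half-integer in the odd case.
\<close>

section \<open>The two-point inequality\<close>

text \<open>The numerator of the quotient's derivative vanishes at 0 and decreases, its own
  derivative being (\<beta>^2 - \<alpha>^2) times a product of nonnegative sinh values. This
  monotonicity yields the single sign change of the derivative of \<open>log_profile\<close> on the
  positive axis.\<close>

lemma sinh_quotient_antimono:
  fixes \<alpha> \<beta> r r' :: real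
  assumes "0 \<le> \<beta>" "\<beta> \<le> \<alpha>" "0 < \<alpha>" "0 < r" "r \<le> r'"
  shows "sinh (\<beta> * r') / sinh (\<alpha> * r') \<le> sinh (\<beta> * r) / sinh (\<alpha> * r)"
proof -
  have k: "\<beta> * cosh (\<beta> * x) * sinh (\<alpha> * x) - \<alpha> * sinh (\<beta> * x) * cosh (\<alpha> * x) \<le> 0" if "0 \<le> x" for x
  proof -
    let ?k = "\<lambda>x. \<beta> * cosh (\<beta> * x) * sinh (\<alpha> * x) - \<alpha> * sinh (\<beta> * x) * cosh (\<alpha> * x)"
    have "?k x \<le> ?k 0"
    proof (rule DERIV_nonpos_imp_nonincreasing[OF that], intro exI conjI)
      fix y :: real
      assume y: "0 \<le> y" "y \<le> x"
      show "DERIV ?k y :> (\<beta>\<^sup>2 - \<alpha>\<^sup>2) * (sinh (\<beta> * y) * sinh (\<alpha> * y))"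
        by (auto intro!: derivative_eq_intros simp: power2_eq_square algebra_simps)
      have "0 \<le> sinh (\<beta> * y) * sinh (\<alpha> * y)"
        using y assms by (intro mult_nonneg_nonneg) auto
      moreover have "\<beta>\<^sup>2 - \<alpha>\<^sup>2 \<le> 0"
        using assms by (simp add: power_mono)
      ultimately show "(\<beta>\<^sup>2 - \<alpha>\<^sup>2) * (sinh (\<beta> * y) * sinh (\<alpha> * y)) \<le> 0"
        by (simp add: mult_nonpos_nonneg)
    qed
    then show ?thesis by simp
  qed
  show ?thesis
  proof (rule DERIV_nonpos_imp_nonincreasing[OF \<open>r \<le> r'\<close>], intro exI conjI)
    fix x :: real
    assume x: "r \<le> x" "x \<le> r'"
    have pos: "0 < sinh (\<alpha> * x)" using x assms by simp
    show "DERIV (\<lambda>x. sinh (\<beta> * x) / sinh (\<alpha> * x)) x :>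
        (\<beta> * cosh (\<beta> * x) * sinh (\<alpha> * x) - \<alpha> * sinh (\<beta> * x) * cosh (\<alpha> * x)) / (sinh (\<alpha> * x))\<^sup>2"
      using pos by (auto intro!: derivative_eq_intros simp: power2_eq_square field_simps)
    show "(\<beta> * cosh (\<beta> * x) * sinh (\<alpha> * x) - \<alpha> * sinh (\<beta> * x) * cosh (\<alpha> * x)) / (sinh (\<alpha> * x))\<^sup>2 \<le> 0"
      using k[of x] x assms by (intro divide_nonpos_nonneg) auto
  qed
qed

text \<open>
  Up to the factor \<open>2 powr (1 - 2 * \<theta>)\<close>, this is the logarithm of the homogeneous ratio of
  \<open>two_point_form \<theta> \<kappa> a b\<close> (below) to \<open>(a + b) powr (2 * \<theta>)\<close>, as a function of \<open>s = ln (a / b)\<close>.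
\<close>

definition log_profile :: "real \<Rightarrow> real \<Rightarrow> real \<Rightarrow> real" where
  "log_profile \<theta> \<kappa> s = ln (cosh (\<theta> * s) + \<kappa>) - 2 * \<theta> * ln (cosh (s / 2))"

text \<open>The subtraction formula for sinh merges the two quotients, so the sign is decided by
  comparing \<open>sinh ((\<theta> - 1/2) * s)\<close> with
  \<open>\<kappa> * sinh (s / 2)\<close>.\<close>

lemma log_profile_deriv:
  assumes "0 \<le> \<kappa>"
  shows "DERIV (log_profile \<theta> \<kappa>) s :> \<theta> * (sinh ((\<theta> - 1/2) * s) - \<kappa> * sinh (s / 2))
           / ((cosh (\<theta> * s) + \<kappa>) * cosh (s / 2))"
proof -
  have pos: "0 < cosh (\<theta> * s) + \<kappa>" "0 < cosh (s / 2)"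
    using assms by (auto intro: add_pos_nonneg)
  have e: "(\<theta> - 1/2) * s = \<theta> * s - s / 2" by (simp add: algebra_simps)
  show ?thesis
    unfolding log_profile_def[abs_def] e sinh_diff using pos
    by (auto intro!: derivative_eq_intros simp: field_simps)
qed

text \<open>\<open>lower\<close> and \<open>upper\<close> make the profile rise up to
  \<open>s0\<close> and fall afterwards; negative arguments follow because cosh, hence the profile,
  is even.\<close>

lemma log_profile_le:
  fixes \<theta> \<kappa> s s0 :: real
  assumes "0 \<le> \<kappa>" "0 \<le> \<theta>" "0 \<le> s0"
    and lower: "\<And>s. 0 \<le> s \<Longrightarrow> s \<le> s0 \<Longrightarrow> \<kappa> * sinh (s / 2) \<le> sinh ((\<theta> - 1/2) * s)"
    and upper: "\<And>s. s0 \<le> s \<Longrightarrow> sinh ((\<theta> - 1/2) * s) \<le> \<kappa> * sinh (s / 2)"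
  shows "log_profile \<theta> \<kappa> s \<le> log_profile \<theta> \<kappa> s0"
proof -
  have den: "0 \<le> (cosh (\<theta> * x) + \<kappa>) * cosh (x / 2)" for x
    using assms by (intro mult_nonneg_nonneg) (auto intro: add_nonneg_nonneg)
  have *: "log_profile \<theta> \<kappa> t \<le> log_profile \<theta> \<kappa> s0" if "0 \<le> t" for t
  proof (cases "t \<le> s0")
    case True
    show ?thesis
    proof (rule DERIV_nonneg_imp_nondecreasing[OF True], intro exI conjI)
      fix x assume "t \<le> x" "x \<le> s0"
      then show "0 \<le> \<theta> * (sinh ((\<theta> - 1/2) * x) - \<kappa> * sinh (x / 2))
           / ((cosh (\<theta> * x) + \<kappa>) * cosh (x / 2))"
        using lower[of x] that assms(2) by (intro divide_nonneg_nonneg[OF mult_nonneg_nonneg den]) auto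
    qed (rule log_profile_deriv[OF assms(1)])
  next
    case False
    then have "s0 \<le> t" by simp
    then show ?thesis
    proof (rule DERIV_nonpos_imp_nonincreasing, intro exI conjI)
      fix x assume "s0 \<le> x" "x \<le> t"
      then show "\<theta> * (sinh ((\<theta> - 1/2) * x) - \<kappa> * sinh (x / 2))
           / ((cosh (\<theta> * x) + \<kappa>) * cosh (x / 2)) \<le> 0"
        using upper[of x] assms(2) den[of x] by (intro divide_nonpos_nonneg mult_nonneg_nonpos) auto
    qed (rule log_profile_deriv[OF assms(1)])
  qed
  have "log_profile \<theta> \<kappa> s = log_profile \<theta> \<kappa> \<bar>s\<bar>"
    by (cases "0 \<le> s") (auto simp: log_profile_def)
  with *[of "\<bar>s\<bar>"] show ?thesis by simp
qed

text \<open>The quadratic form with matrix ((1, \<kappa>), (\<kappa>, 1)) at the vector (a^\<theta>,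
  b^\<theta>): the one-coordinate case of the weighted pair sum.\<close>

definition two_point_form :: "real \<Rightarrow> real \<Rightarrow> real \<Rightarrow> real \<Rightarrow> real" where
  "two_point_form \<theta> \<kappa> a b = a powr (2 * \<theta>) + b powr (2 * \<theta>) + 2 * \<kappa> * (a powr \<theta> * b powr \<theta>)"

text \<open>By homogeneity only the ratio matters: with x = ln a and y = ln b both sides contain the
  factor \<open>exp (\<theta> * (x + y))\<close>, and the rest depends on x - y alone.\<close>

lemma two_point_form_eq_log_profile:
  assumes "0 < a" "0 < b" "0 \<le> \<kappa>"
  shows "two_point_form \<theta> \<kappa> a b =
    2 powr (1 - 2 * \<theta>) * exp (log_profile \<theta> \<kappa> (ln a - ln b)) * (a + b) powr (2 * \<theta>)"
proof -
  define x y where "x = ln a" and "y = ln b"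
  have ab: "a = exp x" "b = exp y" using assms by (auto simp: x_def y_def)
  have pos: "0 < cosh (\<theta> * (x - y)) + \<kappa>" "0 < cosh ((x - y) / 2)"
    using assms by (auto intro: add_pos_nonneg)
  have s: "a + b = 2 * cosh ((x - y) / 2) * exp ((x + y) / 2)"
    unfolding ab cosh_def by (simp add: algebra_simps flip: exp_add) (simp add: field_simps)
  have p: "exp (log_profile \<theta> \<kappa> (x - y)) = (cosh (\<theta> * (x - y)) + \<kappa>) / cosh ((x - y) / 2) powr (2 * \<theta>)"
    using pos by (simp add: log_profile_def exp_diff powr_def mult_ac)
  have q: "(a + b) powr (2 * \<theta>) = 2 powr (2 * \<theta>) * cosh ((x - y) / 2) powr (2 * \<theta>) * exp (\<theta> * (x + y))"
    unfolding s using pos by (simp add: powr_mult) (simp add: powr_def algebra_simps)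
  have "2 powr (1 - 2 * \<theta>) * exp (log_profile \<theta> \<kappa> (x - y)) * (a + b) powr (2 * \<theta>)
     = 2 powr (1 - 2 * \<theta>) * 2 powr (2 * \<theta>) * (cosh (\<theta> * (x - y)) + \<kappa>) * exp (\<theta> * (x + y))"
    unfolding p q using pos by (simp add: field_simps)
  also have "\<dots> = 2 * (cosh (\<theta> * (x - y)) + \<kappa>) * exp (\<theta> * (x + y))"
    by (simp flip: powr_add)
  also have "\<dots> = two_point_form \<theta> \<kappa> a b"
    unfolding two_point_form_def ab cosh_def
    by (simp add: powr_def algebra_simps flip: exp_add)
  finally show ?thesis by (simp add: x_def y_def)
qed

text \<open>For positive a and b this is the maximality of \<open>log_profile\<close> at
  \<open>ln a0 - ln b0\<close>; as \<open>a0 + b0 = 1\<close>, the extremal ratio is the value of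
  the form itself. Zero coordinates are out of reach of the logarithm and are treated by a
  limit.\<close>

lemma two_point_inequality:
  fixes \<theta> \<kappa> a b a0 b0 :: real
  assumes \<kappa>: "0 \<le> \<kappa>" and \<theta>: "0 < \<theta>" and "b0 \<le> a0" "0 < b0" "a0 + b0 = 1"
    and lower: "\<And>s. 0 \<le> s \<Longrightarrow> s \<le> ln a0 - ln b0 \<Longrightarrow> \<kappa> * sinh (s / 2) \<le> sinh ((\<theta> - 1/2) * s)"
    and upper: "\<And>s. ln a0 - ln b0 \<le> s \<Longrightarrow> sinh ((\<theta> - 1/2) * s) \<le> \<kappa> * sinh (s / 2)"
    and ab: "0 \<le> a" "0 \<le> b"
  shows "two_point_form \<theta> \<kappa> a b \<le> two_point_form \<theta> \<kappa> a0 b0 * (a + b) powr (2 * \<theta>)"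
proof -
  define c where "c = two_point_form \<theta> \<kappa> a0 b0"
  have c: "c = 2 powr (1 - 2 * \<theta>) * exp (log_profile \<theta> \<kappa> (ln a0 - ln b0))"
    unfolding c_def by (subst two_point_form_eq_log_profile) (use assms in auto)
  have pos: "two_point_form \<theta> \<kappa> u v \<le> c * (u + v) powr (2 * \<theta>)" if "0 < u" "0 < v" for u v
  proof -
    have "log_profile \<theta> \<kappa> (ln u - ln v) \<le> log_profile \<theta> \<kappa> (ln a0 - ln b0)"
      by (rule log_profile_le) (use assms in auto)
    then show ?thesis
      by (subst two_point_form_eq_log_profile) (use that \<kappa> in \<open>auto simp: c intro!: mult_right_mono mult_left_mono\<close>)
  qed
  \<comment> \<open>When a coordinate is 0 the form equals (a + b)^(2\<theta>), so the claim rests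
    on \<open>1 \<le> c\<close>. This is the limit of \<open>pos\<close> at (1, v) as v tends to 0
    from the right, the form at (1, v) being at least 1.\<close>
  have c1: "1 \<le> c"
  proof -
    have "((\<lambda>v. c * (1 + v) powr (2 * \<theta>)) \<longlongrightarrow> c * (1 + 0) powr (2 * \<theta>)) (at_right 0)"
      by (intro tendsto_intros) auto
    moreover have "eventually (\<lambda>v. 1 \<le> c * (1 + v) powr (2 * \<theta>)) (at_right 0)"
      using eventually_at_right_less[of 0]
    proof eventually_elim
      case (elim v)
      have "1 \<le> two_point_form \<theta> \<kappa> 1 v" using elim \<kappa> by (simp add: two_point_form_def)
      with pos[of 1 v] elim show ?case by simp
    qed
    ultimately show ?thesis
      using tendsto_lowerbound[of "\<lambda>v. c * (1 + v) powr (2 * \<theta>)" "c * (1 + 0) powr (2 * \<theta>)" "at_right 0" 1]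
      by simp
  qed
  show ?thesis
  proof (cases "a = 0 \<or> b = 0")
    case True
    have "1 * (a + b) powr (2 * \<theta>) \<le> c * (a + b) powr (2 * \<theta>)"
      by (rule mult_right_mono[OF c1]) simp
    then show ?thesis using True by (auto simp: two_point_form_def c_def)
  next
    case False
    then show ?thesis using pos[of a b] ab by (simp add: c_def)
  qed
qed

text \<open>The induction over coordinates pairs slices of different sizes, so the diagonal
  inequality is polarised to two independent pairs of weights.\<close>

lemma two_point_bilinear:
  fixes a0 a1 b0 b1 :: real
  assumes c: "\<And>a b. 0 \<le> a \<Longrightarrow> 0 \<le> b \<Longrightarrow> two_point_form \<theta> \<kappa> a b \<le> c * (a + b) powr (2 * \<theta>)"
    and \<kappa>: "0 \<le> \<kappa>" "\<kappa> \<le> 1" and "0 \<le> c"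
    and nn: "0 \<le> a0" "0 \<le> a1" "0 \<le> b0" "0 \<le> b1"
  shows "a0 powr \<theta> * b0 powr \<theta> + a1 powr \<theta> * b1 powr \<theta>
      + \<kappa> * (a0 powr \<theta> * b1 powr \<theta> + a1 powr \<theta> * b0 powr \<theta>)
      \<le> c * (a0 + a1) powr \<theta> * (b0 + b1) powr \<theta>" (is "?B \<le> ?R")
proof -
  have sq: "z powr (2 * \<theta>) = (z powr \<theta>)\<^sup>2" for z :: real
    by (simp add: power2_eq_square flip: powr_add)
  define u0 u1 v0 v1 where "u0 = a0 powr \<theta>" "u1 = a1 powr \<theta>" "v0 = b0 powr \<theta>" "v1 = b1 powr \<theta>"
  let ?Qu = "u0\<^sup>2 + u1\<^sup>2 + 2 * \<kappa> * (u0 * u1)" and ?Qv = "v0\<^sup>2 + v1\<^sup>2 + 2 * \<kappa> * (v0 * v1)"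
  have nnu: "0 \<le> u0" "0 \<le> u1" "0 \<le> v0" "0 \<le> v1" by (auto simp: u0_u1_v0_v1_def)
  have Qu: "?Qu \<le> c * ((a0 + a1) powr \<theta>)\<^sup>2" and Qv: "?Qv \<le> c * ((b0 + b1) powr \<theta>)\<^sup>2"
    using c[of a0 a1] c[of b0 b1] nn by (simp_all add: two_point_form_def sq u0_u1_v0_v1_def)
  \<comment> \<open>Cauchy--Schwarz: the form with matrix \<open>((1, \<kappa>), (\<kappa>, 1))\<close> is positive semidefinite as \<open>\<kappa> \<le> 1\<close>.\<close>
  have "?Qu * ?Qv - (u0 * v0 + u1 * v1 + \<kappa> * (u0 * v1 + u1 * v0))\<^sup>2 = (1 - \<kappa>\<^sup>2) * (u0 * v1 - u1 * v0)\<^sup>2"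
    by (simp add: power2_eq_square algebra_simps)
  also have "\<dots> \<ge> 0" using \<kappa> by (simp add: power_le_one)
  finally have "?B\<^sup>2 \<le> ?Qu * ?Qv" by (simp add: u0_u1_v0_v1_def)
  also have "\<dots> \<le> (c * ((a0 + a1) powr \<theta>)\<^sup>2) * (c * ((b0 + b1) powr \<theta>)\<^sup>2)"
    using Qu Qv nnu \<kappa> \<open>0 \<le> c\<close> by (intro mult_mono) auto
  also have "\<dots> = ?R\<^sup>2" by (simp add: power2_eq_square mult_ac)
  finally show ?thesis by (rule power2_le_imp_le) (use \<open>0 \<le> c\<close> in auto)
qed

section \<open>Tensorisation\<close>

text \<open>Induction on the ground set. Splitting both families by membership of the new element
  gives four pair sums, the two mixed ones with an extra factor \<kappa>; the induction hypothesis
  bounds each by slice sizes and \<open>two_point_bilinear\<close> reassembles them. Two families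
  are needed because the mixed sums pair different slices.\<close>

lemma weighted_pair_sum_le:
  fixes \<theta> \<kappa> c :: real and \<A> \<B> :: "'a set set"
  assumes c: "\<And>a b. 0 \<le> a \<Longrightarrow> 0 \<le> b \<Longrightarrow> two_point_form \<theta> \<kappa> a b \<le> c * (a + b) powr (2 * \<theta>)"
    and \<kappa>: "0 \<le> \<kappa>" "\<kappa> \<le> 1" and "0 \<le> c"
    and "finite U" "\<A> \<subseteq> Pow U" "\<B> \<subseteq> Pow U"
  shows "(\<Sum>S\<in>\<A>. \<Sum>T\<in>\<B>. \<kappa> ^ card (sym_diff S T))
    \<le> c ^ card U * real (card \<A>) powr \<theta> * real (card \<B>) powr \<theta>"
  using assms(5-7)
proof (induction U arbitrary: \<A> \<B> rule: finite_induct)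
  case empty
  \<comment> \<open>A family may be empty; then both sides are 0, because
    \<open>0 powr \<theta> = 0\<close>.\<close>
  then have "\<A> \<in> {{}, {{}}}" "\<B> \<in> {{}, {{}}}" by auto
  then show ?case by auto
next
  case (insert x U)
  let ?P = "\<lambda>\<C> \<D>. \<Sum>S\<in>\<C>. \<Sum>T\<in>\<D>. \<kappa> ^ card (sym_diff S T)"
  \<comment> \<open>\<open>hi\<close> collects the members containing x, with x removed, so that
    both slices consist of subsets of U.\<close>
  define lo hi where "lo \<C> = {S \<in> \<C>. x \<notin> S}" and "hi \<C> = {S. x \<notin> S \<and> insert x S \<in> \<C>}"
    for \<C> :: "'a set set"
  have sub: "lo \<C> \<subseteq> Pow U" "hi \<C> \<subseteq> Pow U" if "\<C> \<subseteq> Pow (insert x U)" for \<C>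
    using that insert.hyps by (auto simp: lo_def hi_def)
  have fin: "finite (lo \<C>)" "finite (hi \<C>)" if "\<C> \<subseteq> Pow (insert x U)" for \<C>
    using sub[OF that] insert.hyps by (auto intro: finite_subset)
  have split: "\<C> = lo \<C> \<union> insert x ` hi \<C>" for \<C>
  proof (rule set_eqI)
    fix S show "S \<in> \<C> \<longleftrightarrow> S \<in> lo \<C> \<union> insert x ` hi \<C>"
    proof (cases "x \<in> S")
      case True
      then have "insert x (S - {x}) = S" by auto
      then show ?thesis using True by (auto simp: lo_def hi_def intro!: image_eqI[of _ _ "S - {x}"])
    qed (auto simp: lo_def)
  qed
  have disj: "lo \<C> \<inter> insert x ` hi \<C> = {}" for \<C> by (auto simp: lo_def)
  have inj: "inj_on (insert x) (hi \<C>)" for \<C> by (auto simp: inj_on_def hi_def)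
  have sum_split: "sum f \<C> = sum f (lo \<C>) + (\<Sum>S\<in>hi \<C>. f (insert x S))"
    if "\<C> \<subseteq> Pow (insert x U)" for \<C> and f :: "'a set \<Rightarrow> real"
    by (subst split[of \<C>], subst sum.union_disjoint)
       (use fin[OF that] disj in \<open>auto simp: sum.reindex[OF inj]\<close>)
  have card_split: "card \<C> = card (lo \<C>) + card (hi \<C>)" if "\<C> \<subseteq> Pow (insert x U)" for \<C>
    by (subst split[of \<C>], subst card_Un_disjoint)
       (use fin[OF that] disj in \<open>auto simp: card_image[OF inj]\<close>)
  have finU: "finite S" if "S \<in> lo \<C> \<union> hi \<C>" "\<C> \<subseteq> Pow (insert x U)" for S \<C>
    using that sub[OF that(2)] finite_subset[OF _ insert.hyps(1), of S] by auto
  have card_both: "card (sym_diff (insert x S) (insert x T)) = card (sym_diff S T)"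
    if "x \<notin> S" "x \<notin> T" for S T
    using that by (intro arg_cong[of _ _ card]) auto
  have card_left: "card (sym_diff (insert x S) T) = Suc (card (sym_diff S T))"
    and card_right: "card (sym_diff T (insert x S)) = Suc (card (sym_diff T S))"
    if "x \<notin> S" "x \<notin> T" "finite S" "finite T" for S T
  proof -
    have "sym_diff (insert x S) T = insert x (sym_diff S T)" "sym_diff T (insert x S) = insert x (sym_diff T S)"
      using that by auto
    then show "card (sym_diff (insert x S) T) = Suc (card (sym_diff S T))"
      "card (sym_diff T (insert x S)) = Suc (card (sym_diff T S))"
      using that by simp_all
  qed
  have notin: "x \<notin> S" if "S \<in> lo \<C> \<union> hi \<C>" for S \<C> using that by (auto simp: lo_def hi_def)
  have A: "\<A> \<subseteq> Pow (insert x U)" and B: "\<B> \<subseteq> Pow (insert x U)" using insert.prems by auto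
  have "?P \<A> \<B> = ?P (lo \<A>) (lo \<B>) + ?P (hi \<A>) (hi \<B>) + \<kappa> * (?P (lo \<A>) (hi \<B>) + ?P (hi \<A>) (lo \<B>))"
  proof -
    have lh: "(\<Sum>S\<in>lo \<A>. \<Sum>T\<in>hi \<B>. \<kappa> ^ card (sym_diff S (insert x T))) = \<kappa> * ?P (lo \<A>) (hi \<B>)"
      unfolding sum_distrib_left
      by (intro sum.cong refl, subst card_right)
         (use finU[OF _ A] finU[OF _ B] notin in \<open>auto simp: sum_distrib_left\<close>)
    have hl: "(\<Sum>S\<in>hi \<A>. \<Sum>T\<in>lo \<B>. \<kappa> ^ card (sym_diff (insert x S) T)) = \<kappa> * ?P (hi \<A>) (lo \<B>)"
      unfolding sum_distrib_left
      by (intro sum.cong refl, subst card_left)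
         (use finU[OF _ A] finU[OF _ B] notin in \<open>auto simp: sum_distrib_left\<close>)
    have hh: "(\<Sum>S\<in>hi \<A>. \<Sum>T\<in>hi \<B>. \<kappa> ^ card (sym_diff (insert x S) (insert x T))) = ?P (hi \<A>) (hi \<B>)"
      by (intro sum.cong refl, subst card_both) (use notin in auto)
    show ?thesis
      unfolding sum_split[OF A] sum_split[OF B] sum.distrib lh hl hh by (simp add: algebra_simps)
  qed
  also have "\<dots> \<le> c ^ card U * real (card (lo \<A>)) powr \<theta> * real (card (lo \<B>)) powr \<theta>
      + c ^ card U * real (card (hi \<A>)) powr \<theta> * real (card (hi \<B>)) powr \<theta>
      + \<kappa> * (c ^ card U * real (card (lo \<A>)) powr \<theta> * real (card (hi \<B>)) powr \<theta>
           + c ^ card U * real (card (hi \<A>)) powr \<theta> * real (card (lo \<B>)) powr \<theta>)"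
    by (intro add_mono mult_left_mono insert.IH sub A B \<kappa>(1))
  also have "\<dots> = c ^ card U * (real (card (lo \<A>)) powr \<theta> * real (card (lo \<B>)) powr \<theta>
      + real (card (hi \<A>)) powr \<theta> * real (card (hi \<B>)) powr \<theta>
      + \<kappa> * (real (card (lo \<A>)) powr \<theta> * real (card (hi \<B>)) powr \<theta>
           + real (card (hi \<A>)) powr \<theta> * real (card (lo \<B>)) powr \<theta>))"
    by (simp add: algebra_simps)
  also have "\<dots> \<le> c ^ card U * (c * (real (card (lo \<A>)) + real (card (hi \<A>))) powr \<theta>
      * (real (card (lo \<B>)) + real (card (hi \<B>))) powr \<theta>)"
    by (intro mult_left_mono two_point_bilinear c \<kappa>) (use \<open>0 \<le> c\<close> in auto)
  also have "\<dots> = c ^ card (insert x U) * real (card \<A>) powr \<theta> * real (card \<B>) powr \<theta>"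
    using insert.hyps by (simp add: card_split[OF A] card_split[OF B] mult_ac)
  finally show ?case .
qed

section \<open>Points of the cube as subsets of the coordinate set\<close>

definition indicator_point :: "nat \<Rightarrow> nat set \<Rightarrow> nat \<Rightarrow> nat" where
  "indicator_point n S = (\<lambda>k\<in>{1..n}. if k \<in> S then 1 else 0)"

lemma inj_on_indicator_point: "inj_on (indicator_point n) (Pow {1..n})"
proof (rule inj_on_inverseI[where g = "\<lambda>x. {k \<in> {1..n}. x k = 1}"])
  fix S assume "S \<in> Pow {1..n}"
  then show "{k \<in> {1..n}. indicator_point n S k = 1} = S"
    by (auto simp: indicator_point_def)
qed

lemma cube_eq_image: "cube n = indicator_point n ` Pow {1..n}"
proof
  show "cube n \<subseteq> indicator_point n ` Pow {1..n}"
  proof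
    fix x assume x: "x \<in> cube n"
    have "x = indicator_point n {k \<in> {1..n}. x k = 1}"
    proof
      fix k
      show "x k = indicator_point n {k \<in> {1..n}. x k = 1} k"
        using x by (cases "k \<in> {1..n}") (auto simp: cube_def indicator_point_def PiE_iff extensional_def)
    qed
    then show "x \<in> indicator_point n ` Pow {1..n}" by blast
  qed
qed (auto simp: cube_def indicator_point_def split: if_splits)

lemma hamming_dist_indicator_point:
  assumes "S \<subseteq> {1..n}" "T \<subseteq> {1..n}"
  shows "hamming_dist n (indicator_point n S) (indicator_point n T) = card (sym_diff S T)"
  unfolding hamming_dist_def
  by (rule arg_cong[of _ _ card]) (use assms in \<open>auto simp: indicator_point_def split: if_splits\<close>)

lemma dist_count_image:
  assumes "\<A> \<subseteq> Pow {1..n}"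
  shows "dist_count n i (indicator_point n ` \<A>) = card {(S, T) \<in> \<A> \<times> \<A>. card (sym_diff S T) = i}"
proof -
  have "{(x, y) \<in> indicator_point n ` \<A> \<times> indicator_point n ` \<A>. hamming_dist n x y = i}
    = map_prod (indicator_point n) (indicator_point n) ` {(S, T) \<in> \<A> \<times> \<A>. card (sym_diff S T) = i}"
  proof (intro equalityI subsetI)
    fix z assume "z \<in> {(x, y) \<in> indicator_point n ` \<A> \<times> indicator_point n ` \<A>. hamming_dist n x y = i}"
    then obtain S T where ST: "S \<in> \<A>" "T \<in> \<A>" "z = (indicator_point n S, indicator_point n T)"
      "hamming_dist n (indicator_point n S) (indicator_point n T) = i" by auto
    then have "(S, T) \<in> {(S, T) \<in> \<A> \<times> \<A>. card (sym_diff S T) = i}"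
      using hamming_dist_indicator_point[of S n T] assms by force
    then show "z \<in> map_prod (indicator_point n) (indicator_point n) ` {(S, T) \<in> \<A> \<times> \<A>. card (sym_diff S T) = i}"
      using ST(3) by force
  next
    fix z assume "z \<in> map_prod (indicator_point n) (indicator_point n) ` {(S, T) \<in> \<A> \<times> \<A>. card (sym_diff S T) = i}"
    then obtain S T where ST: "S \<in> \<A>" "T \<in> \<A>" "z = (indicator_point n S, indicator_point n T)"
      "card (sym_diff S T) = i" by auto
    then show "z \<in> {(x, y) \<in> indicator_point n ` \<A> \<times> indicator_point n ` \<A>. hamming_dist n x y = i}"
      using hamming_dist_indicator_point[of S n T] assms by auto
  qed
  moreover have "inj_on (map_prod (indicator_point n) (indicator_point n)) {(S, T) \<in> \<A> \<times> \<A>. card (sym_diff S T) = i}"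
    by (rule inj_on_subset[OF map_prod_inj_on[OF inj_on_indicator_point inj_on_indicator_point]])
       (use assms in auto)
  ultimately show ?thesis unfolding dist_count_def by (simp add: card_image)
qed

lemma card_indicator_image: "\<A> \<subseteq> Pow {1..n} \<Longrightarrow> card (indicator_point n ` \<A>) = card \<A>"
  by (rule card_image) (rule inj_on_subset[OF inj_on_indicator_point])

text \<open>A pair at distance i contributes exactly \<kappa>^i to the weighted sum over all pairs,
  and every other pair a nonnegative amount; \<open>weighted_pair_sum_le\<close> with equal families
  bounds that sum.\<close>

lemma dist_count_le_two_point:
  fixes \<theta> \<kappa> c :: real
  assumes c: "\<And>a b. 0 \<le> a \<Longrightarrow> 0 \<le> b \<Longrightarrow> two_point_form \<theta> \<kappa> a b \<le> c * (a + b) powr (2 * \<theta>)"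
    and \<kappa>: "0 \<le> \<kappa>" "\<kappa> \<le> 1" and "0 \<le> c" and A: "A \<subseteq> cube n"
  shows "\<kappa> ^ i * real (dist_count n i A) \<le> c ^ n * real (card A) powr (2 * \<theta>)"
proof -
  obtain \<A> where \<A>: "\<A> \<subseteq> Pow {1..n}" "A = indicator_point n ` \<A>"
    using A unfolding cube_eq_image by (meson subset_imageE)
  have fin: "finite \<A>" using \<A>(1) by (rule finite_subset) simp
  let ?D = "{(S, T) \<in> \<A> \<times> \<A>. card (sym_diff S T) = i}"
  have "\<kappa> ^ i * real (card ?D) = (\<Sum>(S, T)\<in>?D. \<kappa> ^ card (sym_diff S T))"
  proof -
    have "(\<Sum>(S, T)\<in>?D. \<kappa> ^ card (sym_diff S T)) = (\<Sum>z\<in>?D. \<kappa> ^ i)"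
      by (rule sum.cong) auto
    then show ?thesis by simp
  qed
  also have "\<dots> \<le> (\<Sum>(S, T)\<in>\<A> \<times> \<A>. \<kappa> ^ card (sym_diff S T))"
    by (rule sum_mono2) (use fin \<kappa> in auto)
  also have "\<dots> = (\<Sum>S\<in>\<A>. \<Sum>T\<in>\<A>. \<kappa> ^ card (sym_diff S T))"
    by (simp add: sum.cartesian_product)
  also have "\<dots> \<le> c ^ card {1..n} * real (card \<A>) powr \<theta> * real (card \<A>) powr \<theta>"
    by (rule weighted_pair_sum_le) (use assms \<A> in auto)
  also have "\<dots> = c ^ n * real (card A) powr (2 * \<theta>)"
    unfolding \<A>(2) card_indicator_image[OF \<A>(1)] by (simp add: mult.assoc flip: powr_add)
  finally show ?thesis
    unfolding \<A>(2) dist_count_image[OF \<A>(1)] .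
qed

section \<open>The upper bound\<close>

text \<open>At half the logarithm of a ratio sinh is algebraic; this turns the critical-point
  equation into an identity in \<sigma> and d.\<close>

lemma sinh_half_ln_diff:
  fixes x y :: real
  assumes "0 < x" "0 < y"
  shows "sinh ((ln x - ln y) / 2) = (x - y) / (2 * sqrt (x * y))"
proof -
  have "(ln x - ln y) / 2 = ln (sqrt x / sqrt y)"
    using assms by (simp add: ln_div ln_sqrt diff_divide_distrib)
  then have "sinh ((ln x - ln y) / 2) = (sqrt x / sqrt y - sqrt y / sqrt x) / 2"
    using assms by (simp add: sinh_ln_real)
  also have "\<dots> = (x - y) / (2 * sqrt (x * y))"
    using assms by (simp add: real_sqrt_mult field_simps)
  finally show ?thesis .
qed

lemma ln2_times_bin_entropy: "bin_entropy t * ln 2 = - t * ln t - (1 - t) * ln (1 - t)"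
  by (simp add: bin_entropy_def log_def field_simps)

lemma dist_count_le_dist_bound:
  fixes n i :: nat and \<sigma> :: real
  assumes \<sigma>: "0 \<le> \<sigma>" "\<sigma> \<le> 1/2" and A: "A \<subseteq> cube n"
    and cardA: "real (card A) \<le> 2 powr (bin_entropy \<sigma> * real n)"
    and i: "1 \<le> i" "real i \<le> 2 * \<sigma> * (1 - \<sigma>) * real n"
  shows "real (dist_count n i A) \<le> dist_bound n \<sigma> i A"
proof -
  have n: "0 < real n" and \<sigma>0: "0 < \<sigma>" using i \<sigma> by (auto intro!: gr0I intro: le_neq_trans)
  \<comment> \<open>The numbers q0, d, d, q1 form a distribution on pairs of bits with both
    marginals (1 - \<sigma>, \<sigma>): the coordinate statistics of two points of density \<sigma>
    at distance i.\<close>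
  define d where "d = real i / real n / 2"
  define q0 q1 where "q0 = 1 - \<sigma> - d" and "q1 = \<sigma> - d"
  have d: "0 < d" "d \<le> \<sigma> * (1 - \<sigma>)" using i n by (auto simp: d_def field_simps)
  have id: "real i = 2 * d * n" using n by (simp add: d_def)
  have q: "0 < q0" "0 < q1"
  proof -
    have "\<sigma> * (1 - \<sigma>) < \<sigma>" using \<sigma>0 by (simp add: algebra_simps)
    with d show "0 < q1" by (simp add: q1_def)
    then show "0 < q0" using \<sigma> by (simp add: q1_def q0_def)
  qed
  define \<kappa> where "\<kappa> = d / sqrt (q0 * q1)"
  have \<kappa>: "0 < \<kappa>" "\<kappa> \<le> 1"
  proof -
    show "0 < \<kappa>" using d q by (simp add: \<kappa>_def)
    \<comment> \<open>Expanding, q0 q1 - d^2 = \<sigma>(1 - \<sigma>) - d, so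
      \<open>\<kappa> \<le> 1\<close> is exactly the upper bound assumed on i.\<close>
    have "d\<^sup>2 \<le> q0 * q1" using d by (simp add: q0_def q1_def power2_eq_square algebra_simps)
    then have "d \<le> sqrt (q0 * q1)" by (rule real_le_rsqrt)
    then show "\<kappa> \<le> 1" using d q by (simp add: \<kappa>_def divide_le_eq_1)
  qed
  define L where "L = ln (1 - \<sigma>) - ln \<sigma>"
  have L: "0 \<le> L" using \<sigma> \<sigma>0 by (simp add: L_def)
  obtain \<theta> where \<theta>: "1/2 \<le> \<theta>" "\<theta> * L = (ln q0 - ln q1) / 2"
    and lower: "\<And>s. 0 \<le> s \<Longrightarrow> s \<le> L \<Longrightarrow> \<kappa> * sinh (s / 2) \<le> sinh ((\<theta> - 1/2) * s)"
    and upper: "\<And>s. L \<le> s \<Longrightarrow> sinh ((\<theta> - 1/2) * s) \<le> \<kappa> * sinh (s / 2)"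
  proof (cases "\<sigma> = 1/2")
    case True
    then have "L = 0" "q0 = q1" by (auto simp: L_def q0_def q1_def)
    \<comment> \<open>Here the equation for \<theta> reads 0 = 0; the choice 1/2 makes
      \<open>sinh ((\<theta> - 1/2) * s)\<close> vanish, and the maximum sits at s = 0.\<close>
    then show ?thesis using \<kappa> by (intro that[of "1/2"]) auto
  next
    case False
    then have \<sigma>1: "\<sigma> < 1/2" using \<sigma> by simp
    have L: "0 < L" using \<sigma>1 \<sigma>0 by (simp add: L_def)
    define \<theta> where "\<theta> = (ln q0 - ln q1) / (2 * L)"
    have \<theta>L: "\<theta> * L = (ln q0 - ln q1) / 2" using L by (simp add: \<theta>_def)
    \<comment> \<open>The next estimates place \<theta> between 1/2 and 1, the range in which
      \<open>sinh_quotient_antimono\<close> applies with \<alpha> = 1/2. The upper end again comes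
      from d \<le> \<sigma>(1 - \<sigma>).\<close>
    have diff: "q0 * \<sigma> - q1 * (1 - \<sigma>) = d * (1 - 2 * \<sigma>)"
      by (simp add: q0_def q1_def algebra_simps)
    have "0 < d * (1 - 2 * \<sigma>)" using d \<sigma>1 by simp
    then have "q1 * (1 - \<sigma>) \<le> q0 * \<sigma>" using diff by linarith
    then have "ln (q1 * (1 - \<sigma>)) \<le> ln (q0 * \<sigma>)"
      using \<sigma>1 \<sigma>0 q by simp
    then have "L \<le> ln q0 - ln q1" using q \<sigma>0 \<sigma>1 by (simp add: ln_mult_pos L_def)
    then have \<theta>1: "1/2 \<le> \<theta>" using L by (simp add: \<theta>_def field_simps)
    have "d * (1 - 2 * \<sigma>) \<le> \<sigma> * (1 - \<sigma>) * (1 - 2 * \<sigma>)"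
      using d \<sigma>1 by (intro mult_right_mono) auto
    then have "q0 * \<sigma>\<^sup>2 \<le> q1 * (1 - \<sigma>)\<^sup>2"
      by (simp add: q0_def q1_def power2_eq_square algebra_simps)
    then have "ln (q0 * \<sigma>\<^sup>2) \<le> ln (q1 * (1 - \<sigma>)\<^sup>2)"
      using q \<sigma>0 \<sigma>1 by simp
    then have "ln q0 - ln q1 \<le> 2 * L" using q \<sigma>0 \<sigma>1 by (simp add: ln_mult_pos ln_realpow L_def)
    then have \<theta>2: "\<theta> \<le> 1" using L by (simp add: \<theta>_def)
    \<comment> \<open>The point s = L is critical for \<open>log_profile\<close>; \<theta>
      disappears from the computation because \<theta> L is half the logarithm of q0 / q1.\<close>
    have crit: "sinh ((\<theta> - 1/2) * L) = \<kappa> * sinh (L / 2)"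
    proof -
      have "(\<theta> - 1/2) * L = (ln (q0 * \<sigma>) - ln (q1 * (1 - \<sigma>))) / 2"
      proof -
        have "ln (q0 * \<sigma>) = ln q0 + ln \<sigma>" "ln (q1 * (1 - \<sigma>)) = ln q1 + ln (1 - \<sigma>)"
          using q \<sigma>0 \<sigma>1 by (auto intro: ln_mult_pos)
        then show ?thesis unfolding left_diff_distrib \<theta>L by (simp add: L_def field_simps)
      qed
      then have "sinh ((\<theta> - 1/2) * L) = d * (1 - 2 * \<sigma>) / (2 * sqrt ((q0 * \<sigma>) * (q1 * (1 - \<sigma>))))"
        using q \<sigma>0 \<sigma>1 by (simp only: sinh_half_ln_diff diff mult_pos_pos)
      also have "\<dots> = \<kappa> * ((1 - 2 * \<sigma>) / (2 * sqrt ((1 - \<sigma>) * \<sigma>)))"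
        using q \<sigma>0 \<sigma>1 by (simp add: \<kappa>_def real_sqrt_mult)
      also have "\<dots> = \<kappa> * sinh (L / 2)"
        using \<sigma>0 \<sigma>1 by (simp add: L_def sinh_half_ln_diff)
      finally show ?thesis .
    qed
    \<comment> \<open>So \<kappa> is the value of the decreasing quotient at L, which gives
      \<open>lower\<close> before L and \<open>upper\<close> after it.\<close>
    have crit': "sinh ((\<theta> - 1/2) * L) / sinh (1/2 * L) = \<kappa>"
      using crit L by simp
    show ?thesis
    proof (rule that[OF \<theta>1 \<theta>L])
      fix s assume s: "0 \<le> s" "s \<le> L"
      show "\<kappa> * sinh (s / 2) \<le> sinh ((\<theta> - 1/2) * s)"
      proof (cases "s = 0")
        case False
        then have "\<kappa> \<le> sinh ((\<theta> - 1/2) * s) / sinh (1/2 * s)"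
          using sinh_quotient_antimono[of "\<theta> - 1/2" "1/2" s L] s \<theta>1 \<theta>2 crit' by simp
        then show ?thesis using False s by (simp add: field_simps)
      qed simp
    next
      fix s assume s: "L \<le> s"
      then have "sinh ((\<theta> - 1/2) * s) / sinh (1/2 * s) \<le> \<kappa>"
        using sinh_quotient_antimono[of "\<theta> - 1/2" "1/2" L s] L \<theta>1 \<theta>2 crit' by simp
      then show "sinh ((\<theta> - 1/2) * s) \<le> \<kappa> * sinh (s / 2)" using L s by (simp add: field_simps)
    qed
  qed
  define c where "c = two_point_form \<theta> \<kappa> (1 - \<sigma>) \<sigma>"
  \<comment> \<open>The equation for \<theta> says that (1 - \<sigma>)^(2\<theta>) / q0 and
    \<sigma>^(2\<theta>) / q1 coincide; \<mu> is the logarithm of the common value.\<close>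
  define \<mu> where "\<mu> = 2 * \<theta> * ln (1 - \<sigma>) - ln q0"
  have \<mu>': "\<mu> = 2 * \<theta> * ln \<sigma> - ln q1" using \<theta>(2) by (simp add: \<mu>_def L_def algebra_simps)
  \<comment> \<open>The three terms of the form at (1 - \<sigma>, \<sigma>) are e^\<mu> times q0, q1
    and 2d, which sum to 1.\<close>
  have c: "c = exp \<mu>"
  proof -
    have e0: "(1 - \<sigma>) powr (2 * \<theta>) = exp \<mu> * q0"
      using \<sigma> q by (simp add: powr_def \<mu>_def exp_diff)
    have e1: "\<sigma> powr (2 * \<theta>) = exp \<mu> * q1"
      using \<sigma>0 q by (simp add: powr_def \<mu>' exp_diff)
    have sq: "z powr (2 * \<theta>) = (z powr \<theta>)\<^sup>2" for z :: real
      by (simp add: power2_eq_square flip: powr_add)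
    have "((1 - \<sigma>) powr \<theta> * \<sigma> powr \<theta>)\<^sup>2 = (exp \<mu> * sqrt (q0 * q1))\<^sup>2"
      using q e0 e1 by (simp add: sq power_mult_distrib) (simp add: power2_eq_square)
    then have e2: "(1 - \<sigma>) powr \<theta> * \<sigma> powr \<theta> = exp \<mu> * sqrt (q0 * q1)"
      using q by (subst (asm) power2_eq_iff_nonneg) auto
    have "c = exp \<mu> * (q0 + q1 + 2 * (\<kappa> * sqrt (q0 * q1)))"
      unfolding c_def two_point_form_def e0 e1 e2 by (simp add: algebra_simps)
    also have "\<kappa> * sqrt (q0 * q1) = d" using q by (simp add: \<kappa>_def)
    finally show ?thesis by (simp add: q0_def q1_def)
  qed
  have tp: "two_point_form \<theta> \<kappa> a b \<le> c * (a + b) powr (2 * \<theta>)" if "0 \<le> a" "0 \<le> b" for a b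
    unfolding c_def
    by (rule two_point_inequality) (use that \<theta> \<kappa> \<sigma> \<sigma>0 lower upper in \<open>auto simp: L_def\<close>)
  have main: "\<kappa> ^ i * real (dist_count n i A) \<le> c ^ n * real (card A) powr (2 * \<theta>)"
    by (rule dist_count_le_two_point[OF tp]) (use \<kappa> c A in auto)
  define h where "h = bin_entropy \<sigma> * ln 2"
  have h: "h = - \<sigma> * ln \<sigma> - (1 - \<sigma>) * ln (1 - \<sigma>)" unfolding h_def by (rule ln2_times_bin_entropy)
  \<comment> \<open>One factor |A| is kept; the size hypothesis is applied to the remaining power,
    whose exponent 2\<theta> - 1 is nonnegative.\<close>
  have card: "real (card A) powr (2 * \<theta>) \<le> real (card A) * exp (h * n * (2 * \<theta> - 1))"
  proof (cases "card A = 0")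
    case False
    have "real (card A) powr (2 * \<theta>) = real (card A) powr (1 + (2 * \<theta> - 1))" by simp
    also have "\<dots> = real (card A) * real (card A) powr (2 * \<theta> - 1)"
      unfolding powr_add by simp
    also have "\<dots> \<le> real (card A) * (2 powr (bin_entropy \<sigma> * real n)) powr (2 * \<theta> - 1)"
      using cardA \<theta> by (intro mult_left_mono powr_mono2) auto
    also have "\<dots> = real (card A) * exp (h * n * (2 * \<theta> - 1))"
      by (simp add: powr_powr) (simp add: powr_def h_def mult_ac)
    finally show ?thesis .
  qed simp
  have \<kappa>i: "\<kappa> ^ i = exp (real i * (ln d - (ln q0 + ln q1) / 2))"
  proof -
    have "ln \<kappa> = ln d - (ln q0 + ln q1) / 2"
      using d q by (simp add: \<kappa>_def ln_div ln_sqrt ln_mult_pos)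
    then show ?thesis using \<kappa> by (simp add: exp_of_nat_mult flip: \<open>ln \<kappa> = _\<close>)
  qed
  define X where "X = \<sigma> * bin_entropy (real i / (2 * \<sigma> * real n))
              + (1 - \<sigma>) * bin_entropy (real i / (2 * (real n - \<sigma> * real n)))"
  \<comment> \<open>In natural units X is the entropy of (q0, d, d, q1) minus that of the marginal
    (1 - \<sigma>, \<sigma>).\<close>
  have X: "X * ln 2 = - 2 * d * ln d - q0 * ln q0 - q1 * ln q1 + \<sigma> * ln \<sigma> + (1 - \<sigma>) * ln (1 - \<sigma>)"
  proof -
    have gen: "t * (bin_entropy (d / t) * ln 2) = - d * ln d - (t - d) * ln (t - d) + t * ln t"
      if "d < t" for t
    proof -
      have "1 - d / t = (t - d) / t" using that d by (simp add: field_simps)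
      then show ?thesis
        unfolding ln2_times_bin_entropy using that d by (simp add: ln_div field_simps)
    qed
    have "real i / (2 * \<sigma> * real n) = d / \<sigma>" "real i / (2 * (real n - \<sigma> * real n)) = d / (1 - \<sigma>)"
      using n \<sigma> \<sigma>0 by (auto simp: d_def field_simps)
    then have "X * ln 2 = \<sigma> * (bin_entropy (d / \<sigma>) * ln 2) + (1 - \<sigma>) * (bin_entropy (d / (1 - \<sigma>)) * ln 2)"
      by (simp add: X_def algebra_simps)
    also have "\<dots> = - 2 * d * ln d - q0 * ln q0 - q1 * ln q1 + \<sigma> * ln \<sigma> + (1 - \<sigma>) * ln (1 - \<sigma>)"
      by (subst (1 2) gen) (use q in \<open>auto simp: q0_def q1_def algebra_simps\<close>)
    finally show ?thesis .
  qed
  \<comment> \<open>Weighting the two expressions for \<mu> by the marginal turns the \<theta>-terms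
    into -2\<theta>h, so that adding h(2\<theta> - 1) leaves only -h.\<close>
  have "\<mu> = (1 - \<sigma>) * \<mu> + \<sigma> * \<mu>" by (simp add: algebra_simps)
  also have "\<dots> = (1 - \<sigma>) * (2 * \<theta> * ln (1 - \<sigma>) - ln q0) + \<sigma> * (2 * \<theta> * ln \<sigma> - ln q1)"
    unfolding \<mu>'[symmetric] unfolding \<mu>_def ..
  finally have "\<mu> + h * (2 * \<theta> - 1) = X * ln 2 + 2 * d * (ln d - (ln q0 + ln q1) / 2)"
    unfolding X h by (simp add: q0_def q1_def algebra_simps add_divide_distrib)
  then have "n * (\<mu> + h * (2 * \<theta> - 1)) = n * (X * ln 2 + 2 * d * (ln d - (ln q0 + ln q1) / 2))"
    by simp
  then have eq: "n * \<mu> + h * n * (2 * \<theta> - 1) = real i * (ln d - (ln q0 + ln q1) / 2) + X * n * ln 2"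
    unfolding id by (simp add: algebra_simps)
  have "\<kappa> ^ i * real (dist_count n i A) \<le> c ^ n * (real (card A) * exp (h * n * (2 * \<theta> - 1)))"
    by (rule order_trans[OF main mult_left_mono[OF card]]) (simp add: c)
  also have "\<dots> = real (card A) * exp (n * \<mu> + h * n * (2 * \<theta> - 1))"
    unfolding c by (simp add: exp_add exp_of_nat_mult)
  also have "\<dots> = \<kappa> ^ i * (real (card A) * 2 powr (X * n))"
    unfolding eq \<kappa>i exp_add by (simp add: powr_def)
  finally show ?thesis
    unfolding dist_bound_def X_def[symmetric] using \<kappa> by simp
qed

section \<open>Stirling bounds\<close>

lemma powr_mult_exp_minus:
  "0 < y \<Longrightarrow> y powr p * exp (- z) = exp (p * ln y - z)" for y p z :: real
  by (simp add: powr_def exp_diff exp_minus divide_inverse)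

text \<open>The constant \<open>exp 1\<close> gives equality at k = 1. The step needs (x + 1/2) ln(1
  + 1/x) \<ge> 1, which is ln(1 + y) \<ge> 2y / (2 + y) at y = 1/x.\<close>

lemma fact_le_stirling:
  assumes "1 \<le> k"
  shows "fact k \<le> exp 1 * (real k powr (real k + 1/2) * exp (- real k))"
  using assms
proof (induction k rule: dec_induct)
  case (step k)
  define x where "x = real k"
  have x: "1 \<le> x" using step by (simp add: x_def)
  have "1 \<le> (x + 1/2) * (ln (x + 1) - ln x)"
  proof -
    have "2 * y / (2 + y) \<le> ln (1 + y)" if "0 \<le> y" for y :: real
    proof -
      let ?f = "\<lambda>y. ln (1 + y) - 2 * y / (2 + y)"
      have "?f 0 \<le> ?f y"
      proof (rule DERIV_nonneg_imp_nondecreasing[OF that], intro exI conjI)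
        fix z :: real assume "0 \<le> z" "z \<le> y"
        then have "DERIV ?f z :> 1 / (1 + z) - (2 * (2 + z) - 2 * z) / ((2 + z) * (2 + z))"
          by (auto intro!: derivative_eq_intros)
        also have "1 / (1 + z) - (2 * (2 + z) - 2 * z) / ((2 + z) * (2 + z)) = z\<^sup>2 / ((1 + z) * (2 + z)\<^sup>2)"
          using \<open>0 \<le> z\<close> by (simp add: divide_simps) (simp add: power2_eq_square algebra_simps)
        finally show "DERIV ?f z :> z\<^sup>2 / ((1 + z) * (2 + z)\<^sup>2)" .
        show "0 \<le> z\<^sup>2 / ((1 + z) * (2 + z)\<^sup>2)" using \<open>0 \<le> z\<close> by simp
      qed
      then show ?thesis by simp
    qed
    from this[of "1 / x"] have "1 / (x + 1/2) \<le> ln (1 + 1 / x)"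
      using x by (simp add: field_simps)
    also have "1 + 1 / x = (x + 1) / x" using x by (simp add: field_simps)
    also have "ln \<dots> = ln (x + 1) - ln x" using x by (simp add: ln_div)
    finally show ?thesis using x by (simp add: pos_divide_le_eq mult.commute)
  qed
  then have "ln (x + 1) + (x + 1/2) * ln x - x \<le> (x + 1 + 1/2) * ln (x + 1) - (x + 1)"
    by (simp add: algebra_simps)
  then have "exp (ln (x + 1) + (x + 1/2) * ln x - x) \<le> exp ((x + 1 + 1/2) * ln (x + 1) - (x + 1))"
    by simp
  also have "exp (ln (x + 1) + (x + 1/2) * ln x - x) = (x + 1) * exp ((x + 1/2) * ln x - x)"
    using x by (simp add: exp_add flip: add_diff_eq)
  finally have *: "(x + 1) * (x powr (x + 1/2) * exp (- x)) \<le> (x + 1) powr (x + 1 + 1/2) * exp (- (x + 1))"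
    using x by (subst (1 2) powr_mult_exp_minus) auto
  have "fact (Suc k) = (x + 1) * fact k" by (simp add: x_def)
  also have "\<dots> \<le> (x + 1) * (exp 1 * (x powr (x + 1/2) * exp (- x)))"
    using step x by (intro mult_left_mono) (auto simp: x_def)
  also have "\<dots> \<le> exp 1 * ((x + 1) powr (x + 1 + 1/2) * exp (- (x + 1)))"
    using mult_left_mono[OF *, of "exp 1"] by (simp only: mult_ac exp_ge_zero)
  finally show ?case by (simp add: x_def add_ac)
qed (simp flip: exp_add)

text \<open>Half-integer arguments of the entropy produce powers with base k + 1/2; k = 0 has to be
  covered, since it occurs for i = 1.\<close>

lemma fact_le_stirling_shifted:
  "fact k \<le> exp 1 * ((real k + 1/2) powr (real k + 1/2) * exp (- real k))"
proof (cases "k = 0")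
  case True
  have "(1/2)\<^sup>2 \<le> (1 / 2 :: real)" by (simp add: power2_eq_square)
  then have "1/2 \<le> sqrt (1 / 2 :: real)" by (rule real_le_rsqrt)
  moreover have "2 \<le> exp (1::real)" using exp_ge_add_one_self[of 1] by simp
  ultimately have "2 * (1/2) \<le> exp 1 * sqrt (1/2 :: real)" by (intro mult_mono) auto
  then show ?thesis using True by (simp add: powr_half_sqrt)
next
  case False
  then have "fact k \<le> exp 1 * (real k powr (real k + 1/2) * exp (- real k))"
    by (intro fact_le_stirling) simp
  also have "\<dots> \<le> exp 1 * ((real k + 1/2) powr (real k + 1/2) * exp (- real k))"
    by (intro mult_left_mono mult_right_mono powr_mono2) auto
  finally show ?thesis .
qed

text \<open>The constant \<open>sqrt 2\<close> gives equality at k = 0. With x = k + 1 and u =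
  1/(2x) the step reduces to \<open>aux\<close>, where the derivative is -ln(1 - u^2).\<close>

lemma stirling_shifted_le_fact:
  "sqrt 2 * ((real k + 1/2) powr (real k + 1/2) * exp (- real k)) \<le> fact k"
proof (induction k)
  case 0
  show ?case by (simp add: powr_half_sqrt flip: real_sqrt_mult)
next
  case (Suc k)
  define x where "x = real k + 1"
  have x: "1 \<le> x" by (simp add: x_def)
  have "0 \<le> 1 + ln x + (x - 1/2) * ln (x - 1/2) - (x + 1/2) * ln (x + 1/2)"
  proof -
    have aux: "0 \<le> 2 * u + (1 - u) * ln (1 - u) - (1 + u) * ln (1 + u)" if "0 \<le> u" "u < 1" for u :: real
    proof -
      let ?f = "\<lambda>u. 2 * u + (1 - u) * ln (1 - u) - (1 + u) * ln (1 + u)"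
      have "?f 0 \<le> ?f u"
      proof (rule DERIV_nonneg_imp_nondecreasing[OF that(1)], intro exI conjI)
        fix z :: real assume z: "0 \<le> z" "z \<le> u"
        then show "DERIV ?f z :> - ln (1 - z) - ln (1 + z)"
          using that by (auto intro!: derivative_eq_intros simp: divide_simps)
        have "ln (1 - z) + ln (1 + z) = ln (1 - z\<^sup>2)"
          using z that by (subst ln_mult_pos[symmetric]) (auto simp: power2_eq_square algebra_simps)
        also have "\<dots> \<le> 0" using z that by (simp add: power_less_one_iff abs_square_less_1)
        finally show "0 \<le> - ln (1 - z) - ln (1 + z)" by simp
      qed
      then show ?thesis by simp
    qed
    have l: "ln (1 - 1 / (2 * x)) = ln (x - 1/2) - ln x" "ln (1 + 1 / (2 * x)) = ln (x + 1/2) - ln x"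
    proof -
      have "1 - 1 / (2 * x) = (x - 1/2) / x" "1 + 1 / (2 * x) = (x + 1/2) / x"
        using x by (simp_all add: field_simps)
      then show "ln (1 - 1 / (2 * x)) = ln (x - 1/2) - ln x" "ln (1 + 1 / (2 * x)) = ln (x + 1/2) - ln x"
        using x by (simp_all only: ln_div) (simp_all add: ln_div)
    qed
    have "0 \<le> x * (2 * (1 / (2 * x)) + (1 - 1 / (2 * x)) * ln (1 - 1 / (2 * x)) - (1 + 1 / (2 * x)) * ln (1 + 1 / (2 * x)))"
      using x by (intro mult_nonneg_nonneg aux) auto
    also have "\<dots> = 1 + (x - 1/2) * ln (1 - 1 / (2 * x)) - (x + 1/2) * ln (1 + 1 / (2 * x))"
      using x by (simp add: field_simps)
    also have "\<dots> = 1 + ln x + (x - 1/2) * ln (x - 1/2) - (x + 1/2) * ln (x + 1/2)"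
      unfolding l by (simp add: algebra_simps)
    finally show ?thesis .
  qed
  then have "(x + 1/2) * ln (x + 1/2) - x \<le> ln x + ((x - 1/2) * ln (x - 1/2) - (x - 1))"
    by (simp add: algebra_simps)
  then have "exp ((x + 1/2) * ln (x + 1/2) - x) \<le> exp (ln x + ((x - 1/2) * ln (x - 1/2) - (x - 1)))"
    by simp
  then have "(x + 1/2) powr (x + 1/2) * exp (- x) \<le> x * ((x - 1/2) powr (x - 1/2) * exp (- (x - 1)))"
    using x by (subst (1 2) powr_mult_exp_minus) (auto simp: exp_add)
  then have "sqrt 2 * ((x + 1/2) powr (x + 1/2) * exp (- x)) \<le> x * (sqrt 2 * ((x - 1/2) powr (x - 1/2) * exp (- (x - 1))))"
    by (simp add: mult.left_commute)
  also have "\<dots> \<le> x * fact k"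
    using Suc x by (intro mult_left_mono) (auto simp: x_def algebra_simps)
  finally show ?case by (simp add: x_def algebra_simps)
qed

lemma stirling_le_fact:
  "sqrt 2 * (real k powr (real k + 1/2) * exp (- real k)) \<le> fact k"
proof -
  have "sqrt 2 * (real k powr (real k + 1/2) * exp (- real k))
     \<le> sqrt 2 * ((real k + 1/2) powr (real k + 1/2) * exp (- real k))"
    by (intro mult_left_mono mult_right_mono powr_mono2) auto
  also note stirling_shifted_le_fact
  finally show ?thesis .
qed

text \<open>The closed form of 2^(m H(h/m)), the entropy approximation to a binomial coefficient; h
  is real so that i/2 may be a half-integer.\<close>

definition entropy_binomial :: "real \<Rightarrow> real \<Rightarrow> real" where
  "entropy_binomial m h = m powr m / (h powr h * (m - h) powr (m - h))"

lemma two_powr_bin_entropy: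
  assumes "0 < h" "h < m"
  shows "2 powr (m * bin_entropy (h / m)) = entropy_binomial m h"
proof -
  have "1 - h / m = (m - h) / m" using assms by (simp add: field_simps)
  then have "m * (bin_entropy (h / m) * ln 2) = m * ln m - h * ln h - (m - h) * ln (m - h)"
    unfolding ln2_times_bin_entropy using assms by (simp add: ln_div field_simps)
  then show ?thesis
    using assms by (simp add: powr_def entropy_binomial_def exp_diff exp_add mult_ac)
qed

text \<open>By Stirling the quotient of the two quantities is of order sqrt(jk/m) with k = m - j.
  Bounding k by m leaves sqrt j, and the factorials of j and k contribute \<open>exp 1\<close>
  each.\<close>

lemma entropy_binomial_le:
  assumes "1 \<le> j" "j < m"
  shows "entropy_binomial m j \<le> exp 2 * sqrt j * real (m choose j)"
proof -
  define k where "k = m - j"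
  have k: "1 \<le> k" "real k = real m - real j" "m = j + k" using assms by (auto simp: k_def)
  define P where "P = (\<lambda>x::nat. real x powr real x)"
  have P: "P x > 0" if "1 \<le> x" for x using that by (simp add: P_def)
  have half: "real x powr (real x + 1/2) = P x * sqrt x" for x :: nat
    by (simp add: P_def powr_add powr_half_sqrt)
  have m: "P m * sqrt m * exp (- real m) \<le> fact m"
  proof -
    have "1 * (P m * sqrt m * exp (- real m)) \<le> sqrt 2 * (P m * sqrt m * exp (- real m))"
      by (rule mult_right_mono) (auto simp: P_def)
    then show ?thesis using stirling_le_fact[of m] by (simp add: half)
  qed
  have "fact j * fact k \<le> (exp 1 * (P j * sqrt j * exp (- real j))) * (exp 1 * (P k * sqrt k * exp (- real k)))"
    using fact_le_stirling[OF assms(1)] fact_le_stirling[OF k(1)] unfolding half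
    by (rule mult_mono) (simp_all add: P_def)
  also have "\<dots> = (exp 1 * exp 1 * exp (- real j) * exp (- real k)) * (sqrt j * (P j * P k) * sqrt k)"
    by (simp only: mult_ac)
  also have "exp 1 * exp 1 * exp (- real j) * exp (- real k) = exp 2 * exp (- real m)"
    by (simp add: k(3) flip: exp_add)
  finally have jk: "fact j * fact k \<le> exp 2 * sqrt j * (P j * P k) * sqrt k * exp (- real m)"
    by (simp only: mult_ac)
  have "P m * (fact j * fact k) \<le> P m * (exp 2 * sqrt j * (P j * P k) * sqrt k * exp (- real m))"
    by (rule mult_left_mono[OF jk]) (simp add: P_def)
  also have "\<dots> \<le> P m * (exp 2 * sqrt j * (P j * P k) * sqrt m * exp (- real m))"
    using k by (intro mult_left_mono mult_right_mono) (auto simp: P_def)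
  also have "\<dots> = exp 2 * sqrt j * (P j * P k) * (P m * sqrt m * exp (- real m))" by simp
  also have "\<dots> \<le> exp 2 * sqrt j * (P j * P k) * fact m"
    by (intro mult_left_mono m) (auto simp: P_def)
  finally have "P m * (fact j * fact k) \<le> exp 2 * sqrt j * (P j * P k) * fact m" .
  moreover have "fact m = real (m choose j) * (fact j * fact k)"
    using k(3) by (simp add: binomial_fact)
  ultimately have "(fact j * fact k) * P m \<le> (fact j * fact k) * (exp 2 * sqrt j * real (m choose j) * (P j * P k))"
    by (simp only: mult_ac)
  then have "P m \<le> exp 2 * sqrt j * real (m choose j) * (P j * P k)"
    by (rule mult_left_le_imp_le) simp
  moreover have "entropy_binomial m j = P m / (P j * P k)"
    unfolding entropy_binomial_def k(2)[symmetric] by (simp add: P_def)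
  ultimately show ?thesis using P[OF assms(1)] P[OF k(1)] by (simp add: pos_divide_le_eq)
qed

text \<open>With m = a + b + 1 the denominator consists of the shifted powers of a and b. Since a +
  b falls short of m by one, a third factor \<open>exp 1\<close> appears.\<close>

lemma entropy_binomial_half_le:
  assumes "a < m"
  shows "entropy_binomial m (real a + 1/2) \<le> exp 3 * sqrt m * real ((m - 1) choose a)"
proof -
  define b where "b = m - 1 - a"
  have b: "m = Suc (a + b)" "real m - (real a + 1/2) = real b + 1/2" using assms by (auto simp: b_def)
  define P where "P = (\<lambda>x::nat. (real x + 1/2) powr (real x + 1/2))"
  have P: "P x > 0" for x by (simp add: P_def)
  define M where "M = real m powr real m"
  have m: "M * sqrt m * exp (- real m) \<le> fact m"
  proof -
    have "1 * (M * sqrt m * exp (- real m)) \<le> sqrt 2 * (M * sqrt m * exp (- real m))"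
      by (rule mult_right_mono) (auto simp: M_def)
    then show ?thesis using stirling_le_fact[of m] by (simp add: M_def powr_add powr_half_sqrt)
  qed
  have "fact a * fact b \<le> (exp 1 * (P a * exp (- real a))) * (exp 1 * (P b * exp (- real b)))"
    using fact_le_stirling_shifted[of a] fact_le_stirling_shifted[of b]
    by (intro mult_mono) (auto simp: P_def)
  also have "\<dots> = P a * P b * (exp 1 * exp (- real a) * exp 1 * exp (- real b))" by simp
  also have "exp 1 * exp (- real a) * exp 1 * exp (- real b) = exp 3 * exp (- real m)"
    by (simp add: b(1) flip: exp_add)
  finally have ab: "fact a * fact b \<le> P a * P b * (exp 3 * exp (- real m))" .
  have "M * sqrt m * (fact a * fact b) \<le> M * sqrt m * (P a * P b * (exp 3 * exp (- real m)))"
    by (rule mult_left_mono[OF ab]) (simp add: M_def)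
  also have "\<dots> = P a * P b * exp 3 * (M * sqrt m * exp (- real m))" by simp
  also have "\<dots> \<le> P a * P b * exp 3 * fact m"
    by (rule mult_left_mono[OF m]) (simp add: P_def)
  finally have *: "M * sqrt m * (fact a * fact b) \<le> P a * P b * exp 3 * fact m" .
  \<comment> \<open>The factor m in m! is split into two square roots: one cancels against
    Stirling's, the other stays in the bound.\<close>
  have fm: "fact m = sqrt m * sqrt m * real ((m - 1) choose a) * (fact a * fact b)"
    by (simp add: b(1) binomial_fact)
  have "sqrt m * (fact a * fact b) * M \<le> sqrt m * (fact a * fact b) * (P a * P b * (exp 3 * sqrt m * real ((m - 1) choose a)))"
    using * unfolding fm by (simp only: mult_ac)
  then have "M \<le> P a * P b * (exp 3 * sqrt m * real ((m - 1) choose a))"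
    by (rule mult_left_le_imp_le) (use assms in auto)
  moreover have "entropy_binomial m (real a + 1/2) = M / (P a * P b)"
    unfolding entropy_binomial_def b(2) by (simp add: M_def P_def)
  ultimately show ?thesis using P[of a] P[of b] by (simp add: pos_divide_le_eq mult_ac)
qed

section \<open>Spheres\<close>

text \<open>T is recovered from P = S - T and Q = T - S as (S - P) \<union> Q, and the two parts are
  chosen independently.\<close>

lemma card_subsets_with_diffs:
  assumes "finite U" "S \<subseteq> U"
  shows "card {T. T \<subseteq> U \<and> card (S - T) = p \<and> card (T - S) = q}
    = (card S choose p) * ((card U - card S) choose q)"
proof -
  let ?B = "{P. P \<subseteq> S \<and> card P = p} \<times> {Q. Q \<subseteq> U - S \<and> card Q = q}"
  have fin: "finite S" using assms finite_subset by blast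
  have "bij_betw (\<lambda>(P, Q). (S - P) \<union> Q) ?B {T. T \<subseteq> U \<and> card (S - T) = p \<and> card (T - S) = q}"
  proof (rule bij_betw_byWitness[where f' = "\<lambda>T. (S - T, T - S)"])
    show "(\<lambda>(P, Q). (S - P) \<union> Q) ` ?B \<subseteq> {T. T \<subseteq> U \<and> card (S - T) = p \<and> card (T - S) = q}"
    proof clarify
      fix P Q assume PQ: "P \<subseteq> S" "Q \<subseteq> U - S" "p = card P" "q = card Q"
      then have "S - ((S - P) \<union> Q) = P" "((S - P) \<union> Q) - S = Q" by auto
      then show "S - P \<union> Q \<subseteq> U \<and> card (S - (S - P \<union> Q)) = card P \<and> card (S - P \<union> Q - S) = card Q"
        using PQ assms by auto
    qed
  qed auto
  then have "card {T. T \<subseteq> U \<and> card (S - T) = p \<and> card (T - S) = q} = card ?B"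
    by (rule bij_betw_same_card[symmetric])
  also have "\<dots> = (card S choose p) * ((card U - card S) choose q)"
    using assms fin by (simp add: card_cartesian_product n_subsets card_Diff_subset)
  finally show ?thesis .
qed

text \<open>Only pairs whose two differences have prescribed sizes are counted. A smaller U serves
  the subcube, and p \<noteq> q serves odd distances.\<close>

lemma binomials_le_dist_count:
  assumes "U \<subseteq> {1..n}" "\<A> \<subseteq> Pow {1..n}"
    and mem: "\<And>S T. S \<subseteq> U \<Longrightarrow> T \<subseteq> U \<Longrightarrow> card S = r \<Longrightarrow> card (S - T) = p \<Longrightarrow> card (T - S) = q
      \<Longrightarrow> S \<in> \<A> \<and> T \<in> \<A>"
  shows "(card U choose r) * (r choose p) * ((card U - r) choose q)
    \<le> dist_count n (p + q) (indicator_point n ` \<A>)"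
proof -
  let ?X = "{S. S \<subseteq> U \<and> card S = r}"
  let ?Y = "\<lambda>S. {T. T \<subseteq> U \<and> card (S - T) = p \<and> card (T - S) = q}"
  have fin: "finite U" "finite \<A>" using assms(1,2) by (auto intro: finite_subset)
  have "(card U choose r) * (r choose p) * ((card U - r) choose q)
      = (\<Sum>S\<in>?X. (r choose p) * ((card U - r) choose q))"
    using fin by (simp add: n_subsets)
  also have "\<dots> = (\<Sum>S\<in>?X. card (?Y S))"
    by (rule sum.cong) (use card_subsets_with_diffs[OF fin(1)] in auto)
  also have "\<dots> = card (Sigma ?X ?Y)"
    using fin by (subst card_SigmaI) auto
  also have "\<dots> \<le> card {(S, T) \<in> \<A> \<times> \<A>. card (sym_diff S T) = p + q}"
  proof (rule card_mono)
    show "finite {(S, T) \<in> \<A> \<times> \<A>. card (sym_diff S T) = p + q}"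
      by (rule finite_subset[of _ "\<A> \<times> \<A>"]) (use fin in auto)
    show "Sigma ?X ?Y \<subseteq> {(S, T) \<in> \<A> \<times> \<A>. card (sym_diff S T) = p + q}"
    proof
      fix z assume "z \<in> Sigma ?X ?Y"
      then obtain S T where ST: "z = (S, T)" "S \<subseteq> U" "T \<subseteq> U" "card S = r" "card (S - T) = p" "card (T - S) = q"
        by blast
      then have "finite S" "finite T" using fin finite_subset by auto
      then have "card (sym_diff S T) = p + q"
        using ST by (subst card_Un_disjoint) auto
      then show "z \<in> {(S, T) \<in> \<A> \<times> \<A>. card (sym_diff S T) = p + q}"
        using mem[of S T] ST by simp
    qed
  qed
  finally show ?thesis by (simp add: dist_count_image[OF assms(2)])
qed

lemma card_eq_of_diffs:
  assumes "finite S" "finite T"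
  shows "card T + card (S - T) = card S + card (T - S)"
proof -
  have "card S = card (S \<inter> T) + card (S - T)" "card T = card (T \<inter> S) + card (T - S)"
    using assms by (simp_all add: card_Diff_subset_Int card_mono)
  then show ?thesis by (simp add: Int_commute)
qed

section \<open>The extremal sets as families of subsets\<close>

lemma hamming_sphere_zero_eq:
  "hamming_sphere n (cube_zero n) r = indicator_point n ` {S. S \<subseteq> {1..n} \<and> card S = r}"
proof -
  have z: "cube_zero n = indicator_point n {}" by (simp add: cube_zero_def indicator_point_def)
  have "hamming_dist n (cube_zero n) (indicator_point n S) = card S" if "S \<subseteq> {1..n}" for S
    unfolding z using hamming_dist_indicator_point[of "{}" n S] that by simp
  then show ?thesis unfolding hamming_sphere_def cube_eq_image by auto
qed

lemma indicator_point_last: "1 \<le> n \<Longrightarrow> indicator_point n S n = (if n \<in> S then 1 else 0)"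
  by (simp add: indicator_point_def)

lemma subcube_two_spheres_eq:
  assumes "1 \<le> n"
  shows "{x \<in> cube n. x n = 0} \<inter> (hamming_sphere n (cube_zero n) r \<union> hamming_sphere n (cube_zero n) s)
    = indicator_point n ` {S. S \<subseteq> {1..n - 1} \<and> (card S = r \<or> card S = s)}"
proof -
  have sub: "S \<subseteq> {1..n - 1} \<longleftrightarrow> S \<subseteq> {1..n} \<and> n \<notin> S" for S
  proof -
    have "{1..n - 1} = {1..n} - {n}" using assms by auto
    then show ?thesis by auto
  qed
  show ?thesis
    unfolding hamming_sphere_zero_eq cube_eq_image sub
    using indicator_point_last[OF assms] by (auto split: if_splits)
qed

text \<open>Dropping a coordinate costs the factor n / (n - k), which is at most 2 for k \<le>
  n/2.\<close>

lemma binomial_le_double_pred: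
  assumes "2 * k \<le> n" "1 \<le> n"
  shows "n choose k \<le> 2 * ((n - 1) choose k)"
proof -
  have "n * (n choose k) \<le> (2 * (n - k)) * (n choose k)"
    using assms by (intro mult_right_mono) auto
  also have "\<dots> = n * (2 * ((n - 1) choose k))"
    using binomial_absorb_comp[of n k] by simp
  finally show ?thesis using assms by simp
qed

text \<open>With \<sigma> n = s the exponent splits into an entropy over the s ones and one over the
  n - s zeros of a sphere point. The side conclusions keep i/2 strictly inside both ranges, as the
  closed form requires.\<close>

lemma dist_bound_eq_entropy_binomial:
  assumes \<sigma>: "real s = \<sigma> * real n" and s: "1 \<le> s" "2 * s \<le> n"
    and i: "1 \<le> i" "real i \<le> 2 * \<sigma> * (1 - \<sigma>) * real n"
  shows "dist_bound n \<sigma> i A = real (card A) * (entropy_binomial s (i / 2) * entropy_binomial (real (n - s)) (i / 2))"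
    and "real i / 2 < real s" "i \<le> n - s"
proof -
  have n: "0 < real n" using s by simp
  have \<sigma>': "\<sigma> = real s / real n" using \<sigma> n by simp
  have m: "real (n - s) = real n - \<sigma> * real n" using s \<sigma> by simp
  have b: "real i \<le> 2 * \<sigma> * real (n - s)" "real i \<le> 2 * real s * (1 - \<sigma>)"
    using i(2) unfolding m \<sigma> by (simp_all add: algebra_simps)
  have \<sigma>2: "0 < \<sigma>" "2 * \<sigma> \<le> 1" using s n by (auto simp: \<sigma>' field_simps)
  have "2 * real s * (1 - \<sigma>) < 2 * real s * 1"
    using s \<sigma>2 by (intro mult_strict_left_mono) auto
  with b show ils: "real i / 2 < real s" by simp
  have "2 * \<sigma> * real (n - s) \<le> 1 * real (n - s)"
    using \<sigma>2 by (intro mult_right_mono) auto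
  with b have im: "real i \<le> real (n - s)" by simp
  then show "i \<le> n - s" by simp
  have e: "(\<sigma> * bin_entropy (real i / (2 * \<sigma> * real n))
              + (1 - \<sigma>) * bin_entropy (real i / (2 * (real n - \<sigma> * real n)))) * real n
      = real s * bin_entropy (real i / 2 / real s) + real (n - s) * bin_entropy (real i / 2 / real (n - s))"
    unfolding m \<sigma> by (simp add: algebra_simps)
  show "dist_bound n \<sigma> i A = real (card A) * (entropy_binomial s (i / 2) * entropy_binomial (real (n - s)) (i / 2))"
    unfolding dist_bound_def e powr_add
    by (subst (1 2) two_powr_bin_entropy) (use ils im i(1) in auto)
qed

text \<open>Pairs arise by exchanging j = i/2 elements of a set for j new ones. The losses sqrt j in
  the two binomial coefficients multiply to j.\<close>

lemma dist_bound_sphere_le: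
  assumes \<sigma>: "real s = \<sigma> * real n" and s: "1 \<le> s" "2 * s \<le> n"
    and i: "1 \<le> i" "real i \<le> 2 * \<sigma> * (1 - \<sigma>) * real n" and "even i"
    and A: "A = hamming_sphere n (cube_zero n) s"
  shows "dist_bound n \<sigma> i A \<le> exp 4 * real i * real (dist_count n i A)"
proof -
  note b = dist_bound_eq_entropy_binomial[OF \<sigma> s i]
  obtain j where j: "i = 2 * j" using \<open>even i\<close> by blast
  have js: "1 \<le> j" "j < s" "j < n - s" using i(1) b(2,3) by (auto simp: j)
  let ?\<A> = "{S. S \<subseteq> {1..n} \<and> card S = s}"
  have A': "A = indicator_point n ` ?\<A>" unfolding A by (rule hamming_sphere_zero_eq)
  have cardA: "card A = n choose s"
    unfolding A' by (subst card_indicator_image) (auto simp: n_subsets)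
  have "(card {1..n} choose s) * (s choose j) * ((card {1..n} - s) choose j) \<le> dist_count n (j + j) A"
    unfolding A'
  proof (rule binomials_le_dist_count)
    fix S T assume ST: "S \<subseteq> {1..n}" "T \<subseteq> {1..n}" "card S = s" "card (S - T) = j" "card (T - S) = j"
    then have "card T = card S" using card_eq_of_diffs[of S T] by (simp add: finite_subset[of _ "{1..n}"])
    then show "S \<in> ?\<A> \<and> T \<in> ?\<A>" using ST by simp
  qed auto
  then have count: "real ((n choose s) * (s choose j) * ((n - s) choose j)) \<le> real (dist_count n i A)"
    by (simp only: of_nat_le_iff) (simp add: j mult_2)
  have "entropy_binomial s j * entropy_binomial (real (n - s)) j
      \<le> (exp 2 * sqrt j * real (s choose j)) * (exp 2 * sqrt j * real ((n - s) choose j))"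
    using js by (intro mult_mono entropy_binomial_le) (auto simp: entropy_binomial_def)
  also have "\<dots> = (exp 2 * exp 2) * (sqrt j * sqrt j) * real ((s choose j) * ((n - s) choose j))"
    by (simp only: mult_ac of_nat_mult)
  also have "\<dots> = exp 4 * real j * real ((s choose j) * ((n - s) choose j))"
    by (simp flip: exp_add)
  finally have "dist_bound n \<sigma> i A \<le> real (n choose s) * (exp 4 * real j * real ((s choose j) * ((n - s) choose j)))"
    unfolding b(1) cardA by (intro mult_left_mono) (auto simp: j simp del: of_nat_diff)
  also have "\<dots> = exp 4 * real j * real ((n choose s) * (s choose j) * ((n - s) choose j))"
    by simp
  also have "\<dots> \<le> exp 4 * real i * real (dist_count n i A)"
    by (intro mult_mono count) (auto simp: j)
  finally show ?thesis .
qed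

lemma dist_bound_two_spheres_le:
  assumes \<sigma>: "real s = \<sigma> * real n" and s: "1 \<le> s" "2 * s \<le> n"
    and i: "1 \<le> i" "real i \<le> 2 * \<sigma> * (1 - \<sigma>) * real n"
    and A: "A = {x \<in> cube n. x n = 0}
       \<inter> (hamming_sphere n (cube_zero n) (s - 1) \<union> hamming_sphere n (cube_zero n) s)"
  shows "dist_bound n \<sigma> i A \<le> 4 * exp 6 * sqrt ((real n - real s) / real s) * real i * real (dist_count n i A)"
proof -
  note b = dist_bound_eq_entropy_binomial[OF \<sigma> s i]
  define m where "m = n - s"
  have m: "s \<le> m" "real n - real s = real m" "n - 1 - s = m - 1" using s by (auto simp: m_def)
  let ?\<A> = "{S. S \<subseteq> {1..n - 1} \<and> (card S = s - 1 \<or> card S = s)}"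
  have A': "A = indicator_point n ` ?\<A>" unfolding A by (rule subcube_two_spheres_eq) (use s in simp)
  have sub: "{1..n - 1} \<subseteq> {1..n}" by auto
  then have sub': "?\<A> \<subseteq> Pow {1..n}" by blast
  \<comment> \<open>By Pascal's rule the two spheres of the subcube together are as large as the
    sphere of radius s in the full cube.\<close>
  have cardA: "card A = n choose s"
  proof -
    have "?\<A> = {S. S \<subseteq> {1..n - 1} \<and> card S = s - 1} \<union> {S. S \<subseteq> {1..n - 1} \<and> card S = s}" by auto
    then have "card ?\<A> = ((n - 1) choose (s - 1)) + ((n - 1) choose s)"
      using s by (simp only:, subst card_Un_disjoint) (auto simp: n_subsets)
    also have "\<dots> = n choose s" using s choose_reduce_nat[of n s] by simp
    finally show ?thesis unfolding A' card_indicator_image[OF sub'] .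
  qed
  have count: "real (((n - 1) choose s) * (s choose p) * ((m - 1) choose q)) \<le> real (dist_count n (p + q) A)"
    if "p = q \<or> p = q + 1" "p \<le> s" for p q
  proof -
    have "(card {1..n - 1} choose s) * (s choose p) * ((card {1..n - 1} - s) choose q) \<le> dist_count n (p + q) A"
      unfolding A'
    proof (rule binomials_le_dist_count[OF sub sub'])
      fix S T assume ST: "S \<subseteq> {1..n - 1}" "T \<subseteq> {1..n - 1}" "card S = s" "card (S - T) = p" "card (T - S) = q"
      then have "card T + p = s + q"
        using card_eq_of_diffs[of S T] by (simp add: finite_subset[of _ "{1..n - 1}"])
      then show "S \<in> ?\<A> \<and> T \<in> ?\<A>" using ST that by auto
    qed
    moreover have "card {1..n - 1} = n - 1" by simp
    ultimately show ?thesis by (simp only: of_nat_le_iff m(3))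
  qed
  have ns: "real (n choose s) \<le> 2 * real ((n - 1) choose s)"
    using of_nat_mono[OF binomial_le_double_pred[of s n], where 'a = real] s by simp
  have ratio: "1 \<le> sqrt (real m / real s)" using m s by simp
  show ?thesis
  proof (cases "even i")
    case True
    then obtain j where j: "i = 2 * j" by blast
    then have "j + j = i" by simp
    have js: "1 \<le> j" "j < s" "j < m" "2 * j \<le> m" using i(1) b(2,3) by (auto simp: j m_def)
    \<comment> \<open>The count involves m - 1 instead of m; 2j = i \<le> n - s keeps the loss
      within a factor 2.\<close>
    have mj: "real (m choose j) \<le> 2 * real ((m - 1) choose j)"
      using of_nat_mono[OF binomial_le_double_pred[of j m], where 'a = real] js by simp
    have "entropy_binomial s j * entropy_binomial m j
        \<le> (exp 2 * sqrt j * real (s choose j)) * (exp 2 * sqrt j * real (m choose j))"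
      using js by (intro mult_mono entropy_binomial_le) (auto simp: entropy_binomial_def)
    also have "\<dots> = (exp 2 * exp 2) * (sqrt j * sqrt j) * (real (s choose j) * real (m choose j))"
      by (simp only: mult_ac)
    also have "\<dots> = exp 4 * real j * (real (s choose j) * real (m choose j))"
      by (simp flip: exp_add)
    finally have "dist_bound n \<sigma> i A \<le> real (n choose s) * (exp 4 * real j * (real (s choose j) * real (m choose j)))"
      unfolding b(1) cardA by (intro mult_left_mono) (auto simp: j m_def simp del: of_nat_diff)
    also have "\<dots> \<le> (2 * real ((n - 1) choose s)) * (exp 4 * real j * (real (s choose j) * (2 * real ((m - 1) choose j))))"
      by (intro mult_mono ns mj order_refl) auto
    also have "\<dots> = (4 * exp 4 * 1 * real j) * real (((n - 1) choose s) * (s choose j) * ((m - 1) choose j))"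
      by simp
    \<comment> \<open>The square root is at least 1 because s \<le> m, so it is inserted only to
      match the odd case.\<close>
    also have "\<dots> \<le> (4 * exp 6 * sqrt (real m / real s) * real i) * real (dist_count n (j + j) A)"
      using js ratio by (intro mult_mono count) (auto simp: j)
    finally show ?thesis unfolding m(2) \<open>j + j = i\<close> .
  next
    case False
    then obtain j where j: "i = 2 * j + 1" by (elim oddE)
    then have "j + 1 + j = i" by simp
    have h: "real i / 2 = real j + 1/2" by (simp add: j)
    have js: "j < s" "j < m" using b(2,3) by (auto simp: j m_def)
    have "entropy_binomial s (j + 1/2) * entropy_binomial m (j + 1/2)
        \<le> (exp 3 * sqrt s * real ((s - 1) choose j)) * (exp 3 * sqrt m * real ((m - 1) choose j))"
      using js by (intro mult_mono entropy_binomial_half_le) (auto simp: entropy_binomial_def)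
    also have "\<dots> = (exp 3 * exp 3) * (sqrt s * sqrt m) * real ((s - 1) choose j) * real ((m - 1) choose j)"
      by (simp only: mult_ac)
    also have "\<dots> = exp 6 * (sqrt s * sqrt m) * real ((s - 1) choose j) * real ((m - 1) choose j)"
      by (simp flip: exp_add)
    \<comment> \<open>A full factor s is split off so that absorption can raise
      \<open>(s - 1) choose j\<close> to \<open>s choose (j + 1)\<close>, the coefficient counted
      with p = j + 1 and q = j. The resulting factor j + 1 is at most i.\<close>
    also have "sqrt s * sqrt m = sqrt (real m / real s) * real s"
      using s by (simp add: real_sqrt_divide field_simps)
    also have "exp 6 * (sqrt (real m / real s) * real s) * real ((s - 1) choose j) * real ((m - 1) choose j)
        = exp 6 * sqrt (real m / real s) * real (s * ((s - 1) choose j)) * real ((m - 1) choose j)"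
      by simp
    also have "s * ((s - 1) choose j) = (j + 1) * (s choose (j + 1))"
      using binomial_absorption[of j s] by simp
    finally have "dist_bound n \<sigma> i A \<le> real (n choose s) *
        (exp 6 * sqrt (real m / real s) * real ((j + 1) * (s choose (j + 1))) * real ((m - 1) choose j))"
      unfolding b(1) cardA h m_def[symmetric] by (intro mult_left_mono) auto
    also have "\<dots> \<le> (2 * real ((n - 1) choose s)) *
        (exp 6 * sqrt (real m / real s) * real ((j + 1) * (s choose (j + 1))) * real ((m - 1) choose j))"
      by (intro mult_right_mono ns) auto
    also have "\<dots> = (2 * exp 6 * sqrt (real m / real s) * real (j + 1))
        * real (((n - 1) choose s) * (s choose (j + 1)) * ((m - 1) choose j))"
      by (simp only: of_nat_mult mult_ac)
    also have "\<dots> \<le> (4 * exp 6 * sqrt (real m / real s) * real i) * real (dist_count n (j + 1 + j) A)"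
      using js ratio by (intro mult_mono count) (auto simp: j)
    finally show ?thesis unfolding m(2) \<open>j + 1 + j = i\<close> .
  qed
qed

theorem theorem1p6:
  shows "(\<forall>(n::nat) (\<sigma>::real) A (i::nat).
            0 \<le> \<sigma> \<and> \<sigma> \<le> 1 / 2 \<and> A \<subseteq> cube n
            \<and> real (card A) \<le> 2 powr (bin_entropy \<sigma> * real n)
            \<and> 1 \<le> i \<and> real i \<le> 2 * \<sigma> * (1 - \<sigma>) * real n
            \<longrightarrow> real (dist_count n i A) \<le> dist_bound n \<sigma> i A)
         \<and> (\<exists>C::real. \<forall>(n::nat) (\<sigma>::real) (s::nat) (i::nat).
              0 \<le> \<sigma> \<and> \<sigma> \<le> 1 / 2 \<and> real s = \<sigma> * real n \<and> 1 \<le> s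
              \<and> 1 \<le> i \<and> real i \<le> 2 * \<sigma> * (1 - \<sigma>) * real n
              \<longrightarrow> (even i \<longrightarrow>
                    (let A = hamming_sphere n (cube_zero n) s
                     in dist_bound n \<sigma> i A \<le> C * real i * real (dist_count n i A)))
                \<and> (let A = {x \<in> cube n. x n = 0}
                           \<inter> (hamming_sphere n (cube_zero n) (s - 1)
                              \<union> hamming_sphere n (cube_zero n) s)
                   in dist_bound n \<sigma> i A
                      \<le> C * sqrt ((real n - real s) / real s) * real i * real (dist_count n i A)))"
proof (rule conjI)
  show "\<forall>(n::nat) (\<sigma>::real) A (i::nat).
            0 \<le> \<sigma> \<and> \<sigma> \<le> 1 / 2 \<and> A \<subseteq> cube n
            \<and> real (card A) \<le> 2 powr (bin_entropy \<sigma> * real n)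
            \<and> 1 \<le> i \<and> real i \<le> 2 * \<sigma> * (1 - \<sigma>) * real n
            \<longrightarrow> real (dist_count n i A) \<le> dist_bound n \<sigma> i A"
    using dist_count_le_dist_bound by blast
next
  have double: "2 * s \<le> n" if "\<sigma> \<le> 1/2" "real s = \<sigma> * real n" for \<sigma> :: real and s n :: nat
    using mult_right_mono[OF that(1), of "real n"] that(2) by simp
  \<comment> \<open>A single constant has to serve both clauses, so the sphere bound is weakened
    from \<open>exp 4\<close> to \<open>4 * exp 6\<close>.\<close>
  have sphere: "dist_bound n \<sigma> i A \<le> 4 * exp 6 * real i * real (dist_count n i A)"
    if "dist_bound n \<sigma> i A \<le> exp 4 * real i * real (dist_count n i A)" for n \<sigma> i A
  proof -
    have "exp 4 \<le> exp (6::real)" "0 \<le> exp (6::real)" by simp_all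
    then have "exp 4 \<le> 4 * exp (6::real)" by linarith
    then have "exp 4 * (real i * real (dist_count n i A)) \<le> 4 * exp 6 * (real i * real (dist_count n i A))"
      by (rule mult_right_mono) simp
    with that show ?thesis by (simp add: mult.assoc)
  qed
  show "\<exists>C::real. \<forall>(n::nat) (\<sigma>::real) (s::nat) (i::nat).
              0 \<le> \<sigma> \<and> \<sigma> \<le> 1 / 2 \<and> real s = \<sigma> * real n \<and> 1 \<le> s
              \<and> 1 \<le> i \<and> real i \<le> 2 * \<sigma> * (1 - \<sigma>) * real n
              \<longrightarrow> (even i \<longrightarrow>
                    (let A = hamming_sphere n (cube_zero n) s
                     in dist_bound n \<sigma> i A \<le> C * real i * real (dist_count n i A)))
                \<and> (let A = {x \<in> cube n. x n = 0}
                           \<inter> (hamming_sphere n (cube_zero n) (s - 1)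
                              \<union> hamming_sphere n (cube_zero n) s)
                   in dist_bound n \<sigma> i A
                      \<le> C * sqrt ((real n - real s) / real s) * real i * real (dist_count n i A))"
    unfolding Let_def
  proof (intro exI[of _ "4 * exp 6"] allI impI, elim conjE, intro conjI impI)
    fix n s i :: nat and \<sigma> :: real
    assume *: "\<sigma> \<le> 1 / 2" "real s = \<sigma> * real n" "1 \<le> s" "1 \<le> i"
      "real i \<le> 2 * \<sigma> * (1 - \<sigma>) * real n"
    note h = *(2,3) double[OF *(1,2)] *(4,5)
    let ?A = "{x \<in> cube n. x n = 0}
       \<inter> (hamming_sphere n (cube_zero n) (s - 1) \<union> hamming_sphere n (cube_zero n) s)"
    show "dist_bound n \<sigma> i ?A
        \<le> 4 * exp 6 * sqrt ((real n - real s) / real s) * real i * real (dist_count n i ?A)"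
      by (rule dist_bound_two_spheres_le[OF h refl])
    let ?B = "hamming_sphere n (cube_zero n) s"
    show "dist_bound n \<sigma> i ?B \<le> 4 * exp 6 * real i * real (dist_count n i ?B)" if "even i"
      by (rule sphere[OF dist_bound_sphere_le[OF h that refl]])
  qed
qed

end
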